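(* Let $n\ge2$, $1\le s\le n-1$, $m>0$, $\mu>0$. Consider the adaptive compressed sensing setting with observations $\vec{Y}=\vec{A}\vec{x}+\vec{W}$, where $\vec{W}$ is Gaussian with zero mean and identity covariance matrix, the rows of $\vec{A}$ may be designed sequentially and adaptively, and $\mathbb{E}\bigl[\|\vec{A}\|_F^2\bigr]\le m$. Let $\mathcal{C}'$ be the class of all subsets of $\{1,\ldots,n\}$ of cardinality $s$, $s+1$ or $s-1$, and let $$\mathcal{H}(\mu)=\Bigl\{\vec{x}\in\mathbb{R}^n:\ \mathrm{supp}(\vec{x})\in\mathcal{C}'\ \text{ and }\ \min_i\{|x_i|:x_i\neq0\}\ge\mu\Bigr\}.$$ Let $D=\{\vec{Y},\vec{A}\}$ and let $\hat S(D)$ be an arbitrary estimator of the support $S=\mathrm{supp}(\vec{x})$. If $$\max_{\vec{x}\in\mathcal{H}(\mu)}\mathbb{E}_{\vec{x}}\bigl[d(\hat S,S)\bigr]\le\epsilon,$$ where $0<\epsilon<1$, then necessarily $$\mu\ \ge\ \sqrt{\frac{2n}{m}\left(\log s+\log\frac{n-s}{n+1}+\log\frac{1}{2\epsilon}\right)}.$$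
   Context: Adaptive compressed sensing: $\vec{Y}\in\mathbb{R}^l$ are the observations, $\vec{A}\in\mathbb{R}^{l\times n}$ is the sensing matrix, $\vec{x}\in\mathbb{R}^n$ the unknown signal, and $\vec{W}\in\mathbb{R}^l$ the noise. The number $l$ of measurements is unrestricted and may be infinite. The $k$th row $\vec{A}_{k\cdot}$ may depend (possibly with extra randomization, but not on the unknown $\vec{x}$ otherwise) on $\{Y_j,\vec{A}_{j\cdot}\}_{j=1}^{k-1}$, and $W_k$ is a standard normal variable independent of $\{Y_j,\vec{A}_{j\cdot},W_j\}_{j=1}^{k-1}$ and of $\vec{A}_{k\cdot}$. $\|\cdot\|_F$ is the Frobenius norm, and the budget constraint $\mathbb{E}[\|\vec{A}\|_F^2]\le m$ is imposed under every signal $\vec{x}$ considered. $\mathbb{E}_{\vec{x}}$ denotes expectation when the signal is $\vec{x}$. $\mathrm{supp}(\vec{x})=\{i:x_i\neq0\}$; the minimum over an empty set is $+\infty$. An estimator $\hat S$ is a measurable function of $D$ with values in the subsets of $\{1,\ldots,n\}$, and $d(\hat S,S)=|\hat S\,\Delta\,S|$ is the cardinality of the symmetric difference. The maximum over $\mathcal{H}(\mu)$ is understood as a supremum. If the quantity under the square root is negative, the lower bound is understood to be vacuous. *)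

theory Defs
  imports "HOL-Probability.Probability" "HOL-Library.Extended_Nat"
begin

(* Measurements are indexed by k = 0, 1, 2, ... with k < l; l = \<infinity> is allowed.
   The ambient dimension is CARD('n). *)

definition measurements :: "enat \<Rightarrow> nat set" where
  "measurements l = {k. enat k < l}"

definition data_space :: "nat set \<Rightarrow> (nat \<Rightarrow> real \<times> (real ^ 'n)) measure" where
  "data_space I = PiM I (\<lambda>_. borel \<Otimes>\<^sub>M borel)"

definition sensing_data ::
    "nat set \<Rightarrow> (nat \<Rightarrow> 'a \<Rightarrow> real) \<Rightarrow> (nat \<Rightarrow> 'a \<Rightarrow> real ^ 'n) \<Rightarrow> 'a \<Rightarrow> nat \<Rightarrow> real \<times> (real ^ 'n)" where
  "sensing_data I Y A \<omega> = (\<lambda>j\<in>I. (Y j \<omega>, A j \<omega>))"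

(* A randomized adaptive design: for each k a Markov kernel that chooses the law of row k from
   the past observations and rows. It has no access to the signal. Randomization through a hidden
   seed, independent of the noise and possibly reused across rows, is covered as well: given the
   past, the law of the seed does not depend on the signal. *)
definition sensing_strategy ::
    "enat \<Rightarrow> (nat \<Rightarrow> (nat \<Rightarrow> real \<times> (real ^ 'n)) \<Rightarrow> (real ^ 'n) measure) \<Rightarrow> bool" where
  "sensing_strategy l Q \<longleftrightarrow>
     (\<forall>k\<in>measurements l. Q k \<in> data_space {..<k} \<rightarrow>\<^sub>M prob_algebra borel)"

(* The library's indep_var requires both variables to have the same codomain type. *)
definition (in prob_space) indep_rv ::
    "'b measure \<Rightarrow> ('a \<Rightarrow> 'b) \<Rightarrow> 'c measure \<Rightarrow> ('a \<Rightarrow> 'c) \<Rightarrow> bool" where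
  "indep_rv S X T Z \<longleftrightarrow>
     random_variable S X \<and> random_variable T Z \<and>
     indep_set (sets (vimage_algebra (space M) X S)) (sets (vimage_algebra (space M) Z T))"

(* The experiment under one fixed signal x: A k is the k-th row of the sensing matrix, W k the
   noise and Y k the observation. The assumption row says that Q k is a regular conditional
   distribution of A k given the past {(Y j, A j)} for j < k, i.e. the joint law of the past and
   A k is the law of the past followed by the kernel Q k. *)
locale adaptive_sensing = prob_space M
  for M :: "'a measure" +
  fixes l :: enat
    and Q :: "nat \<Rightarrow> (nat \<Rightarrow> real \<times> (real ^ 'n)) \<Rightarrow> (real ^ 'n) measure"
    and x :: "real ^ 'n"
    and A :: "nat \<Rightarrow> 'a \<Rightarrow> real ^ 'n"
    and W :: "nat \<Rightarrow> 'a \<Rightarrow> real"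
    and Y :: "nat \<Rightarrow> 'a \<Rightarrow> real"
  assumes row_measurable: "\<And>k. k \<in> measurements l \<Longrightarrow> random_variable borel (A k)"
    and observation:
      "\<And>k \<omega>. k \<in> measurements l \<Longrightarrow> \<omega> \<in> space M \<Longrightarrow> Y k \<omega> = A k \<omega> \<bullet> x + W k \<omega>"
    and row:
      "\<And>k. k \<in> measurements l \<Longrightarrow>
         distr M (data_space {..<k} \<Otimes>\<^sub>M borel) (\<lambda>\<omega>. (sensing_data {..<k} Y A \<omega>, A k \<omega>)) =
         distr M (data_space {..<k}) (sensing_data {..<k} Y A) \<bind>
           (\<lambda>h. distr (Q k h) (data_space {..<k} \<Otimes>\<^sub>M borel) (Pair h))"
    and noise_normal:
      "\<And>k. k \<in> measurements l \<Longrightarrow> distributed M lborel (W k) std_normal_density"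
    and noise_indep:
      "\<And>k. k \<in> measurements l \<Longrightarrow>
         indep_rv
           (PiM {..<k} (\<lambda>_. borel \<Otimes>\<^sub>M borel \<Otimes>\<^sub>M borel) \<Otimes>\<^sub>M borel)
           (\<lambda>\<omega>. (\<lambda>j\<in>{..<k}. (Y j \<omega>, A j \<omega>, W j \<omega>), A k \<omega>))
           borel (W k)"

definition frobenius_sq :: "enat \<Rightarrow> (nat \<Rightarrow> 'a \<Rightarrow> real ^ 'n) \<Rightarrow> 'a \<Rightarrow> ennreal" where
  "frobenius_sq l A \<omega> =
     (\<Sum>k. if k \<in> measurements l then (\<Sum>i\<in>UNIV. ennreal ((A k \<omega> $ i)\<^sup>2)) else 0)"

definition supp :: "real ^ 'n \<Rightarrow> 'n set" where
  "supp x = {i. x $ i \<noteq> 0}"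

definition support_class :: "nat \<Rightarrow> 'n::finite set set" where
  "support_class s = {S. card S = s \<or> card S = s + 1 \<or> card S = s - 1}"

(* The infimum is taken in the extended reals, so that it is \<infinity> for x = 0 (empty support). *)
definition signal_class :: "nat \<Rightarrow> real \<Rightarrow> (real ^ 'n) set" where
  "signal_class s \<mu> =
     {x. supp x \<in> support_class s \<and> (INF i\<in>supp x. ereal \<bar>x $ i\<bar>) \<ge> ereal \<mu>}"

definition support_dist :: "'n::finite set \<Rightarrow> 'n set \<Rightarrow> nat" where
  "support_dist T S = card ((T - S) \<union> (S - T))"

end

theory Submission
  imports Defs
begin

text \<open>For a support \<open>S\<close> of size \<open>s\<close>, compare the signal with all entries \<open>\<mu>\<close> on \<open>S\<close> with the
  \<open>n\<close> signals obtained by adding or deleting one coordinate \<open>i\<close>. The log likelihood ratio of the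
  data has mean \<open>- \<mu>\<^sup>2 / 2 * E_S (\<Sum>k. A k $ i ^ 2)\<close> under \<open>S\<close>, whatever the adaptive design, so
  the two error probabilities at \<open>i\<close> sum to at least half the exponential of that mean
  (the Bretagnolle-Huber inequality). Only the budget under \<open>S\<close> enters; convexity of \<open>exp\<close> distributes it evenly
  over the \<open>n\<close> coordinates, which gives a sum of at least \<open>n / 2 * exp (- \<mu>\<^sup>2 m / (2 n))\<close>. Summing over all
  \<open>S\<close> of size \<open>s\<close>, each pair of a neighbouring support and a coordinate is hit at most once, so the
  risk assumption bounds the same quantity by
  \<open>(binom n s + binom n (s + 1) + binom n (s - 1)) \<epsilon>\<close>.\<close>

section \<open>The Bretagnolle-Huber inequality, pointwise and integrated\<close>

text \<open>Being linear in \<open>z\<close> and \<open>exp z\<close>, the lower bound integrates directly to the Bretagnolle-Huber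
  inequality, with neither Jensen nor Cauchy-Schwarz.\<close>

lemma min_one_exp_ge:
  fixes c z :: real
  shows "exp (- c) * (3 / 4 + (z + c) / 2 - exp z / 4) \<le> min 1 (exp z)"
proof -
  define u where "u = exp (z / 2)"
  define r where "r = exp (- c / 2)"
  have u: "u > 0" "exp z = u\<^sup>2" by (simp_all add: u_def exp_double[symmetric])
  have r: "r > 0" "exp (- c) = r\<^sup>2" by (simp_all add: r_def exp_double[symmetric])
  have ur: "r * exp ((z + c) / 2) = u"
    by (simp add: r_def u_def flip: exp_add) (simp add: field_simps)
  \<comment> \<open>The tangent bound \<open>1 + (z + c) / 2 \<le> exp ((z + c) / 2)\<close>
    accounts for the constant 3/4, which is 1 - 1/4. In the new variables, \<open>exp (- c)\<close>
    times that exponential is \<open>r * u\<close>.\<close>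
  have "exp (- c) * (3 / 4 + (z + c) / 2 - exp z / 4)
      \<le> r\<^sup>2 * (exp ((z + c) / 2) - (1 + u\<^sup>2) / 4)"
    unfolding r u
  proof (rule mult_left_mono)
    define e where "e = (z + c) / 2"
    show "3 / 4 + (z + c) / 2 - u\<^sup>2 / 4 \<le> exp ((z + c) / 2) - (1 + u\<^sup>2) / 4"
      unfolding e_def[symmetric] using exp_ge_add_one_self[of e] unfolding add_divide_distrib by linarith
  qed simp
  also have "\<dots> = r * u - r\<^sup>2 * (1 + u\<^sup>2) / 4"
    by (simp add: ur[symmetric] power2_eq_square algebra_simps)
  \<comment> \<open>Each of the two bounds follows by completing squares: 1, respectively
    \<open>u\<^sup>2\<close>, minus the left side is a sum of two squares.\<close>
  also have "\<dots> \<le> min 1 (u\<^sup>2)"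
  proof (rule min.boundedI)
    have "r * u - r\<^sup>2 * (1 + u\<^sup>2) / 4 = 1 - (1 - r * u / 2)\<^sup>2 - (r / 2)\<^sup>2"
      by (simp add: power2_eq_square field_simps)
    then show "r * u - r\<^sup>2 * (1 + u\<^sup>2) / 4 \<le> 1"
      using zero_le_power2[of "1 - r * u / 2"] zero_le_power2[of "r / 2"] by linarith
    have "r * u - r\<^sup>2 * (1 + u\<^sup>2) / 4 = u\<^sup>2 - (u - r / 2)\<^sup>2 - (r * u / 2)\<^sup>2"
      by (simp add: power2_eq_square field_simps)
    then show "r * u - r\<^sup>2 * (1 + u\<^sup>2) / 4 \<le> u\<^sup>2"
      using zero_le_power2[of "u - r / 2"] zero_le_power2[of "r * u / 2"] by linarith
  qed
  finally show ?thesis by (simp only: u)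
qed

text \<open>If \<open>Z\<close> is a log likelihood ratio, then \<open>exp Z\<close> is the density
  of a second law, and the right side adds the two error probabilities of the test \<open>E\<close>.
  Its integrand is 1 or \<open>exp Z\<close> at each point, hence at least
  \<open>min 1 (exp Z)\<close>. Integrating the bound of \<open>min_one_exp_ge\<close> leaves a
  factor of at least 3/4 - 1/4 = 1/2.\<close>

lemma (in prob_space) error_sum_ge_exp:
  fixes Z :: "'a \<Rightarrow> real"
  assumes Z: "integrable M Z" "- c \<le> expectation Z"
    and eZ: "integrable M (\<lambda>\<omega>. exp (Z \<omega>))" "expectation (\<lambda>\<omega>. exp (Z \<omega>)) \<le> 1"
    and E: "E \<in> events"
  shows "exp (- c) / 2 \<le> prob E + (\<integral>\<omega>. indicator (space M - E) \<omega> * exp (Z \<omega>) \<partial>M)"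
proof -
  have i: "integrable M (\<lambda>\<omega>. indicator E \<omega> :: real)"
    "integrable M (\<lambda>\<omega>. indicator (space M - E) \<omega> * exp (Z \<omega>))"
    using E eZ by (auto intro!: integrable_real_mult_indicator simp: mult.commute emeasure_eq_measure)
  have "exp (- c) / 2 \<le> exp (- c) * (3 / 4 + (expectation Z + c) / 2 - expectation (\<lambda>\<omega>. exp (Z \<omega>)) / 4)"
    using mult_left_mono[of "1 / 2" "3 / 4 + (expectation Z + c) / 2 - expectation (\<lambda>\<omega>. exp (Z \<omega>)) / 4"
        "exp (- c)"] Z eZ by (simp add: field_simps)
  also have "\<dots> = (\<integral>\<omega>. exp (- c) * (3 / 4 + (Z \<omega> + c) / 2 - exp (Z \<omega>) / 4) \<partial>M)"
    using Z eZ by (simp add: prob_space)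
  also have "\<dots> \<le> (\<integral>\<omega>. indicator E \<omega> + indicator (space M - E) \<omega> * exp (Z \<omega>) \<partial>M)"
  proof (intro integral_mono)
    fix \<omega> assume "\<omega> \<in> space M"
    then show "exp (- c) * (3 / 4 + (Z \<omega> + c) / 2 - exp (Z \<omega>) / 4)
        \<le> indicator E \<omega> + indicator (space M - E) \<omega> * exp (Z \<omega>)"
      using min_one_exp_ge[of c "Z \<omega>"] by (auto split: split_indicator)
  qed (use Z eZ i in auto)
  also have "\<dots> = prob E + (\<integral>\<omega>. indicator (space M - E) \<omega> * exp (Z \<omega>) \<partial>M)"
    using i E by simp
  finally show ?thesis .
qed

section \<open>Independence and product laws\<close>

lemma (in prob_space) indep_rv_prob:
  assumes "indep_rv S X T Z" "g \<in> S \<rightarrow>\<^sub>M S'" "C \<in> sets S'" "B \<in> sets T"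
  shows "prob ((\<lambda>\<omega>. g (X \<omega>)) -` C \<inter> space M \<inter> (Z -` B \<inter> space M)) =
    prob ((\<lambda>\<omega>. g (X \<omega>)) -` C \<inter> space M) * prob (Z -` B \<inter> space M)"
proof -
  have X: "X \<in> M \<rightarrow>\<^sub>M S" and Z: "Z \<in> M \<rightarrow>\<^sub>M T"
    and ind: "indep_set (sets (vimage_algebra (space M) X S)) (sets (vimage_algebra (space M) Z T))"
    using assms(1) by (auto simp: indep_rv_def)
  have "(\<lambda>\<omega>. g (X \<omega>)) -` C \<inter> space M = X -` (g -` C \<inter> space S) \<inter> space M"
    using measurable_space[OF X] by auto
  moreover have "g -` C \<inter> space S \<in> sets S" using assms(2,3) by (rule measurable_sets)
  ultimately have "(\<lambda>\<omega>. g (X \<omega>)) -` C \<inter> space M \<in> sets (vimage_algebra (space M) X S)"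
    by (metis in_vimage_algebra)
  moreover have "Z -` B \<inter> space M \<in> sets (vimage_algebra (space M) Z T)"
    using assms(4) by (rule in_vimage_algebra)
  ultimately show ?thesis using indep_setD[OF ind] by auto
qed

text \<open>Both sides agree on rectangles, which determine a product of two probability
  measures.\<close>

lemma (in prob_space) indep_rv_distr_Pair:
  assumes ind: "indep_rv S X T Z" and g: "g \<in> S \<rightarrow>\<^sub>M S'"
  shows "distr M (S' \<Otimes>\<^sub>M T) (\<lambda>\<omega>. (g (X \<omega>), Z \<omega>)) = distr M S' (\<lambda>\<omega>. g (X \<omega>)) \<Otimes>\<^sub>M distr M T Z"
proof -
  have X[measurable]: "X \<in> M \<rightarrow>\<^sub>M S" and Z[measurable]: "Z \<in> M \<rightarrow>\<^sub>M T"
    using ind by (auto simp: indep_rv_def)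
  note g[measurable]
  interpret A: prob_space "distr M S' (\<lambda>\<omega>. g (X \<omega>))" by (rule prob_space_distr) measurable
  interpret B: prob_space "distr M T Z" by (rule prob_space_distr) measurable
  show ?thesis
  proof (rule pair_measure_eqI[symmetric])
    fix C B assume C[measurable]: "C \<in> sets (distr M S' (\<lambda>\<omega>. g (X \<omega>)))" and B[measurable]: "B \<in> sets (distr M T Z)"
    have "(\<lambda>\<omega>. (g (X \<omega>), Z \<omega>)) -` (C \<times> B) \<inter> space M =
        (\<lambda>\<omega>. g (X \<omega>)) -` C \<inter> space M \<inter> (Z -` B \<inter> space M)" by auto
    then show "emeasure (distr M S' (\<lambda>\<omega>. g (X \<omega>))) C * emeasure (distr M T Z) B =
        emeasure (distr M (S' \<Otimes>\<^sub>M T) (\<lambda>\<omega>. (g (X \<omega>), Z \<omega>))) (C \<times> B)"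
      using C B indep_rv_prob[OF ind g, of C B]
      by (simp add: emeasure_distr emeasure_eq_measure ennreal_mult)
  qed (auto intro: A.sigma_finite_measure_axioms B.sigma_finite_measure_axioms)
qed

text \<open>Once the codomains agree, \<open>indep_var\<close> becomes available, and with it the
  product formula for expectations.\<close>

lemma (in prob_space) indep_rv_imp_indep_var:
  assumes ind: "indep_rv S X T Z" and g: "g \<in> S \<rightarrow>\<^sub>M T"
  shows "indep_var T (\<lambda>\<omega>. g (X \<omega>)) T Z"
  using ind g indep_rv_distr_Pair[OF ind g]
  by (subst indep_var_distribution_eq) (auto simp: indep_rv_def intro: measurable_compose)

section \<open>The likelihood ratio of the past\<close>

lemma borel_measurable_real_vec[measurable]:
  "(\<lambda>a :: real ^ 'n. a $ i) \<in> borel_measurable borel"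
  by (intro borel_measurable_continuous_onI continuous_intros)

lemma measurements_downward: "k \<in> measurements l \<Longrightarrow> {..k} \<subseteq> measurements l"
  by (auto simp: measurements_def) (meson enat_ord_simps(1) order_le_less_trans)

context adaptive_sensing
begin

abbreviation "past k \<equiv> sensing_data {..<k} Y A"

lemma noise_measurable[measurable (raw)]: "k \<in> measurements l \<Longrightarrow> random_variable borel (W k)"
  using noise_normal[of k] by (auto dest: distributed_measurable)

declare row_measurable[measurable (raw)]

lemma observation_measurable[measurable (raw)]:
  assumes "k \<in> measurements l" shows "random_variable borel (Y k)"
proof -
  have "random_variable borel (\<lambda>\<omega>. A k \<omega> \<bullet> x + W k \<omega>)" using assms by measurable
  then show ?thesis using observation[OF assms] by (subst measurable_cong) auto
qed

lemma sensing_data_measurable: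
  "J \<subseteq> measurements l \<Longrightarrow> sensing_data J Y A \<in> M \<rightarrow>\<^sub>M data_space J"
  unfolding sensing_data_def data_space_def
  by (intro measurable_restrict measurable_Pair observation_measurable row_measurable) auto

lemma past_measurable[measurable (raw)]: "k \<in> measurements l \<Longrightarrow> past k \<in> M \<rightarrow>\<^sub>M data_space {..<k}"
  using measurements_downward[of k l] by (intro sensing_data_measurable) auto

lemma past_Suc:
  assumes "k \<in> measurements l" "\<omega> \<in> space M"
  shows "past (Suc k) \<omega> = (past k \<omega>)(k := (A k \<omega> \<bullet> x + W k \<omega>, A k \<omega>))"
  using observation[OF assms] by (auto simp: sensing_data_def fun_eq_iff less_Suc_eq)

end

lemma measurable_data_space_upd[measurable (raw)]:
  assumes [measurable]: "f \<in> N \<rightarrow>\<^sub>M data_space {..<k}" "g \<in> borel_measurable N" "h \<in> borel_measurable N"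
  shows "(\<lambda>\<omega>. (f \<omega>)(k := (g \<omega>, h \<omega>))) \<in> N \<rightarrow>\<^sub>M data_space {..<Suc k}"
proof -
  have "(\<lambda>(f, y). f(k := y)) \<in> data_space {..<k} \<Otimes>\<^sub>M (borel \<Otimes>\<^sub>M borel) \<rightarrow>\<^sub>M data_space {..<Suc k}"
    unfolding data_space_def lessThan_Suc by measurable
  from measurable_compose[OF _ this, of "\<lambda>\<omega>. (f \<omega>, (g \<omega>, h \<omega>))" N]
  show ?thesis by simp
qed

context adaptive_sensing
begin

text \<open>The assumption \<open>noise_indep\<close> speaks of triples that include the earlier
  noise; the projection \<open>?g\<close> forgets that component.\<close>

lemma distr_row_noise:
  assumes k: "k \<in> measurements l"
  shows "distr M ((data_space {..<k} \<Otimes>\<^sub>M borel) \<Otimes>\<^sub>M borel) (\<lambda>\<omega>. ((past k \<omega>, A k \<omega>), W k \<omega>)) =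
    distr M (data_space {..<k} \<Otimes>\<^sub>M borel) (\<lambda>\<omega>. (past k \<omega>, A k \<omega>)) \<Otimes>\<^sub>M distr M borel (W k)"
proof -
  let ?g = "\<lambda>(h :: nat \<Rightarrow> real \<times> (real ^ 'n) \<times> real, a :: real ^ 'n). (\<lambda>j\<in>{..<k}. (fst (h j), fst (snd (h j))), a)"
  have "?g \<in> PiM {..<k} (\<lambda>_. borel \<Otimes>\<^sub>M borel \<Otimes>\<^sub>M borel) \<Otimes>\<^sub>M borel \<rightarrow>\<^sub>M data_space {..<k} \<Otimes>\<^sub>M borel"
    unfolding data_space_def split_beta
    by (intro measurable_Pair measurable_restrict) (measurable)
  from indep_rv_distr_Pair[OF noise_indep[OF k] this] show ?thesis
    by (simp add: sensing_data_def restrict_def cong: if_cong)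
qed

text \<open>This is what centres the cross terms
  \<open>A k \<omega> \<bullet> v * W k \<omega>\<close> of the log likelihood ratio.\<close>

lemma indep_var_row_noise:
  assumes k: "k \<in> measurements l"
  shows "indep_var borel (\<lambda>\<omega>. A k \<omega> \<bullet> v) borel (W k)"
proof -
  have "(\<lambda>(h, a). a \<bullet> v) \<in> PiM {..<k} (\<lambda>_. borel \<Otimes>\<^sub>M borel \<Otimes>\<^sub>M borel) \<Otimes>\<^sub>M borel \<rightarrow>\<^sub>M borel"
    by measurable
  from indep_rv_imp_indep_var[OF noise_indep[OF k] this] show ?thesis by simp
qed

text \<open>One step of the experiment: given the past, the row is drawn from \<open>Q k\<close>,
  then the observation from the unit variance normal law centred at \<open>a \<bullet> x\<close>.
  The kernel does not involve the signal, so two signals can be compared by induction on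
  \<open>k\<close>.\<close>

lemma nn_integral_past_Suc:
  fixes f :: "_ \<Rightarrow> ennreal"
  assumes Q: "sensing_strategy l Q" and k: "k \<in> measurements l"
    and f[measurable]: "f \<in> borel_measurable (data_space {..<Suc k})"
  shows "(\<integral>\<^sup>+\<omega>. f (past (Suc k) \<omega>) \<partial>M) =
    (\<integral>\<^sup>+\<omega>. \<integral>\<^sup>+a. \<integral>\<^sup>+y. std_normal_density (y - a \<bullet> x) * f ((past k \<omega>)(k := (y, a)))
      \<partial>lborel \<partial>Q k (past k \<omega>) \<partial>M)"
proof -
  note [measurable] = row_measurable[OF k] noise_measurable[OF k] past_measurable[OF k]
  have Qk[measurable]: "Q k \<in> data_space {..<k} \<rightarrow>\<^sub>M subprob_algebra borel"
    using Q k by (auto simp: sensing_strategy_def intro: measurable_prob_algebraD)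
  let ?P = "data_space {..<k} \<Otimes>\<^sub>M borel"
  let ?g = "\<lambda>((h, a), w). f (h(k := (a \<bullet> x + w, a)))"
  define G where "G h a = (\<integral>\<^sup>+y. std_normal_density (y - a \<bullet> x) * f (h(k := (y, a))) \<partial>lborel)" for h a
  have G[measurable]: "(\<lambda>p. G (fst p) (snd p)) \<in> borel_measurable ?P"
    unfolding G_def by measurable
  have [measurable]: "?g \<in> borel_measurable (?P \<Otimes>\<^sub>M borel)"
    unfolding split_beta by measurable
  interpret W: prob_space "distr M borel (W k)" by (rule prob_space_distr) simp
  have inner: "(\<integral>\<^sup>+w. ?g (p, w) \<partial>distr M borel (W k)) = G (fst p) (snd p)" if p: "p \<in> space ?P" for p
  proof -
    obtain h a where [simp]: "p = (h, a)" by (cases p)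
    have [measurable]: "h \<in> space (data_space {..<k})" using p by (simp add: space_pair_measure)
    have "(\<integral>\<^sup>+w. ?g (p, w) \<partial>distr M borel (W k)) = (\<integral>\<^sup>+\<omega>. f (h(k := (a \<bullet> x + W k \<omega>, a))) \<partial>M)"
      by (simp add: nn_integral_distr)
    also have "\<dots> = (\<integral>\<^sup>+w. std_normal_density w * f (h(k := (a \<bullet> x + w, a))) \<partial>lborel)"
      by (rule distributed_nn_integral[OF noise_normal[OF k], symmetric]) measurable
    \<comment> \<open>Substitution \<open>y = a \<bullet> x + w\<close>, from the noise to the
      observation.\<close>
    also have "\<dots> = G h a"
      unfolding G_def by (subst nn_integral_real_affine[where c = 1 and t = "a \<bullet> x"]) auto
    finally show ?thesis by simp
  qed
  have "(\<integral>\<^sup>+\<omega>. f (past (Suc k) \<omega>) \<partial>M) = (\<integral>\<^sup>+\<omega>. ?g ((past k \<omega>, A k \<omega>), W k \<omega>) \<partial>M)"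
    by (intro nn_integral_cong) (simp add: past_Suc[OF k])
  also have "\<dots> = (\<integral>\<^sup>+q. ?g q \<partial>distr M (?P \<Otimes>\<^sub>M borel) (\<lambda>\<omega>. ((past k \<omega>, A k \<omega>), W k \<omega>)))"
    by (rule nn_integral_distr[symmetric]) measurable
  also have "\<dots> = (\<integral>\<^sup>+p. \<integral>\<^sup>+w. ?g (p, w) \<partial>distr M borel (W k) \<partial>distr M ?P (\<lambda>\<omega>. (past k \<omega>, A k \<omega>)))"
    unfolding distr_row_noise[OF k] by (rule W.nn_integral_fst[symmetric]) measurable
  also have "\<dots> = (\<integral>\<^sup>+p. G (fst p) (snd p) \<partial>distr M ?P (\<lambda>\<omega>. (past k \<omega>, A k \<omega>)))"
    by (intro nn_integral_cong inner) simp
  \<comment> \<open>By the assumption \<open>row\<close> the joint law of past and row is a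
    \<open>bind\<close>, so the integral splits into one over the past and one over
    \<open>Q k\<close>.\<close>
  also have "\<dots> = (\<integral>\<^sup>+h. \<integral>\<^sup>+p. G (fst p) (snd p) \<partial>distr (Q k h) ?P (Pair h) \<partial>distr M (data_space {..<k}) (past k))"
    unfolding row[OF k]
  proof (rule nn_integral_bind[where B = ?P])
    show "(\<lambda>h. distr (Q k h) ?P (Pair h)) \<in> distr M (data_space {..<k}) (past k) \<rightarrow>\<^sub>M subprob_algebra ?P"
      using measurable_distr2[OF _ Qk, of Pair ?P] by simp
  qed measurable
  also have "\<dots> = (\<integral>\<^sup>+\<omega>. \<integral>\<^sup>+p. G (fst p) (snd p) \<partial>distr (Q k (past k \<omega>)) ?P (Pair (past k \<omega>)) \<partial>M)"
    by (rule nn_integral_distr) (auto intro!: nn_integral_measurable_subprob_algebra2[where N = ?P] measurable_distr2[where M = borel])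
  also have "\<dots> = (\<integral>\<^sup>+\<omega>. \<integral>\<^sup>+a. G (past k \<omega>) a \<partial>Q k (past k \<omega>) \<partial>M)"
  proof (intro nn_integral_cong)
    fix \<omega> assume "\<omega> \<in> space M"
    then have h: "past k \<omega> \<in> space (data_space {..<k})" by (rule measurable_space[OF past_measurable[OF k]])
    then have "sets (Q k (past k \<omega>)) = sets borel" by (rule sets_kernel[OF Qk])
    with h show "(\<integral>\<^sup>+p. G (fst p) (snd p) \<partial>distr (Q k (past k \<omega>)) ?P (Pair (past k \<omega>))) = (\<integral>\<^sup>+a. G (past k \<omega>) a \<partial>Q k (past k \<omega>))"
      by (subst nn_integral_distr) (auto cong: measurable_cong_sets)
  qed
  finally show ?thesis by (simp add: G_def)
qed

end

text \<open>Logarithm of the density of the first \<open>k\<close> data under \<open>x'\<close>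
  relative to \<open>x\<close>. The row kernels are common to both signals and cancel, so only the
  Gaussian factors of the observations remain.\<close>

definition log_likelihood_ratio ::
    "real ^ 'n \<Rightarrow> real ^ 'n \<Rightarrow> nat \<Rightarrow> (nat \<Rightarrow> real \<times> (real ^ 'n)) \<Rightarrow> real" where
  "log_likelihood_ratio x x' k h =
     (\<Sum>j<k. ((fst (h j) - snd (h j) \<bullet> x)\<^sup>2 - (fst (h j) - snd (h j) \<bullet> x')\<^sup>2) / 2)"

lemma log_likelihood_ratio_measurable[measurable]:
  "log_likelihood_ratio x x' k \<in> borel_measurable (data_space {..<k})"
  unfolding log_likelihood_ratio_def[abs_def] data_space_def by measurable

lemma std_normal_density_times_exp:
  "std_normal_density u * exp ((u\<^sup>2 - v\<^sup>2) / 2) = std_normal_density v"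
  by (simp add: std_normal_density_def diff_divide_distrib flip: exp_add)

text \<open>Induction on \<open>k\<close>, peeling off the last measurement under both signals. The
  new likelihood factor turns the density centred at \<open>a \<bullet> x\<close> into the one
  centred at \<open>a \<bullet> x'\<close>, the row kernel is the same on both sides, and what is
  left of the ratio depends on the past alone.\<close>

lemma change_of_measure:
  fixes f :: "(nat \<Rightarrow> real \<times> (real ^ 'n)) \<Rightarrow> ennreal"
  assumes P: "adaptive_sensing M l Q x A W Y" and P': "adaptive_sensing M' l Q x' A' W' Y'"
    and Q: "sensing_strategy l Q" and k: "{..<k} \<subseteq> measurements l"
    and f: "f \<in> borel_measurable (data_space {..<k})"
  shows "(\<integral>\<^sup>+\<omega>. f (sensing_data {..<k} Y' A' \<omega>) \<partial>M') =
    (\<integral>\<^sup>+\<omega>. f (sensing_data {..<k} Y A \<omega>) *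
      exp (log_likelihood_ratio x x' k (sensing_data {..<k} Y A \<omega>)) \<partial>M)"
  using k f
proof (induction k arbitrary: f)
  case 0
  interpret P: adaptive_sensing M l Q x A W Y by fact
  interpret P': adaptive_sensing M' l Q x' A' W' Y' by fact
  show ?case
    by (simp add: sensing_data_def log_likelihood_ratio_def P.emeasure_space_1 P'.emeasure_space_1)
next
  case (Suc k)
  interpret P: adaptive_sensing M l Q x A W Y by fact
  interpret P': adaptive_sensing M' l Q x' A' W' Y' by fact
  have k: "k \<in> measurements l" and sub: "{..<k} \<subseteq> measurements l" using Suc.prems(1) by auto
  note [measurable] = Suc.prems(2)
  have Qk[measurable]: "Q k \<in> data_space {..<k} \<rightarrow>\<^sub>M subprob_algebra borel"
    using Q k by (auto simp: sensing_strategy_def intro: measurable_prob_algebraD)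
  define G where "G h a = (\<integral>\<^sup>+y. std_normal_density (y - a \<bullet> x') * f (h(k := (y, a))) \<partial>lborel)" for h a
  have G[measurable]: "(\<lambda>(h, a). G h a) \<in> borel_measurable (data_space {..<k} \<Otimes>\<^sub>M borel)"
    unfolding G_def split_beta by measurable
  have [measurable]: "(\<lambda>h. \<integral>\<^sup>+a. G h a \<partial>Q k h) \<in> borel_measurable (data_space {..<k})"
    by (rule nn_integral_measurable_subprob_algebra2[OF G Qk])
  let ?L = "\<lambda>k h. ennreal (exp (log_likelihood_ratio x x' k h))"
  have inner: "(\<integral>\<^sup>+a. \<integral>\<^sup>+y. std_normal_density (y - a \<bullet> x) *
        (f (h(k := (y, a))) * ?L (Suc k) (h(k := (y, a)))) \<partial>lborel \<partial>Q k h) = (\<integral>\<^sup>+a. G h a \<partial>Q k h) * ?L k h"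
    if h[measurable]: "h \<in> space (data_space {..<k})" for h
  proof -
    have s: "sets (Q k h) = sets borel" using h by (rule sets_kernel[OF Qk])
    have L: "log_likelihood_ratio x x' (Suc k) (h(k := (y, a))) =
        log_likelihood_ratio x x' k h + ((y - a \<bullet> x)\<^sup>2 - (y - a \<bullet> x')\<^sup>2) / 2" for y a
      by (simp add: log_likelihood_ratio_def)
    have "ennreal (std_normal_density (y - a \<bullet> x)) * (f (h(k := (y, a))) * ?L (Suc k) (h(k := (y, a)))) =
        std_normal_density (y - a \<bullet> x') * f (h(k := (y, a))) * ?L k h" for y a
      unfolding L exp_add
      by (simp add: std_normal_density_times_exp[of "y - a \<bullet> x" "y - a \<bullet> x'", symmetric] ennreal_mult mult_ac)
    then have "(\<integral>\<^sup>+y. std_normal_density (y - a \<bullet> x) *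
        (f (h(k := (y, a))) * ?L (Suc k) (h(k := (y, a)))) \<partial>lborel) = G h a * ?L k h" for a
      unfolding G_def by (simp add: nn_integral_multc)
    moreover have "G h \<in> borel_measurable borel" using measurable_Pair2[OF G h] by simp
    then have "G h \<in> borel_measurable (Q k h)" by (simp cong: measurable_cong_sets add: s)
    ultimately show ?thesis by (simp add: nn_integral_multc)
  qed
  have "(\<integral>\<^sup>+\<omega>. f (sensing_data {..<Suc k} Y' A' \<omega>) \<partial>M') =
      (\<integral>\<^sup>+\<omega>. \<integral>\<^sup>+a. G (sensing_data {..<k} Y' A' \<omega>) a \<partial>Q k (sensing_data {..<k} Y' A' \<omega>) \<partial>M')"
    unfolding G_def by (rule P'.nn_integral_past_Suc[OF Q k]) fact
  \<comment> \<open>The induction hypothesis is applied to a new function of the past, namely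
    \<open>f\<close> with the last row and observation integrated out; hence the generalization over
    \<open>f\<close>.\<close>
  also have "\<dots> = (\<integral>\<^sup>+\<omega>. (\<integral>\<^sup>+a. G (sensing_data {..<k} Y A \<omega>) a \<partial>Q k (sensing_data {..<k} Y A \<omega>)) *
      ?L k (sensing_data {..<k} Y A \<omega>) \<partial>M)"
    by (rule Suc.IH[OF sub]) measurable
  also have "\<dots> = (\<integral>\<^sup>+\<omega>. f (sensing_data {..<Suc k} Y A \<omega>) * ?L (Suc k) (sensing_data {..<Suc k} Y A \<omega>) \<partial>M)"
    using measurable_space[OF P.past_measurable[OF k]]
    by (subst P.nn_integral_past_Suc[OF Q k]) (auto intro!: nn_integral_cong inner[symmetric])
  finally show ?case .
qed

section \<open>Mean of the log likelihood ratio\<close>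

context adaptive_sensing
begin

lemma expectation_noise:
  assumes k: "k \<in> measurements l"
  shows "integrable M (W k)" "expectation (W k) = 0"
proof -
  have "integrable lborel (\<lambda>w. std_normal_density w * w)"
    using integrable_std_normal_moment[of 1] by simp
  then show "integrable M (W k)"
    by (rule distributed_integrable_var[OF noise_normal[OF k], rotated]) simp
  show "expectation (W k) = 0"
    using standard_normal_distributed_expectation[OF noise_normal[OF k]] by simp
qed

text \<open>Under \<open>x\<close> the residual of measurement \<open>j\<close> with respect to
  \<open>x\<close> is \<open>W j\<close>, and with respect to \<open>x'\<close> it is
  \<open>W j\<close> minus the inner product of the row with \<open>x' - x\<close>; expanding the
  squares gives the formula.\<close>

lemma log_likelihood_ratio_past:
  assumes "{..<k} \<subseteq> measurements l" "\<omega> \<in> space M"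
  shows "log_likelihood_ratio x x' k (past k \<omega>) =
    (\<Sum>j<k. A j \<omega> \<bullet> (x' - x) * W j \<omega> - (A j \<omega> \<bullet> (x' - x))\<^sup>2 / 2)"
  unfolding log_likelihood_ratio_def
proof (rule sum.cong[OF refl])
  fix j assume j: "j \<in> {..<k}"
  then have "Y j \<omega> = A j \<omega> \<bullet> x + W j \<omega>" using assms observation by auto
  then show "((fst (past k \<omega> j) - snd (past k \<omega> j) \<bullet> x)\<^sup>2 - (fst (past k \<omega> j) - snd (past k \<omega> j) \<bullet> x')\<^sup>2) / 2 =
      A j \<omega> \<bullet> (x' - x) * W j \<omega> - (A j \<omega> \<bullet> (x' - x))\<^sup>2 / 2"
    using j by (simp add: sensing_data_def inner_diff_right power2_eq_square field_simps)
qed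

text \<open>Each row is independent of the noise in its own measurement, so the cross terms have
  mean zero however the row was chosen from the past. Square integrability of the row factor makes
  the product integrable.\<close>

lemma expectation_log_likelihood_ratio:
  assumes k: "{..<k} \<subseteq> measurements l"
    and int: "\<And>j. j < k \<Longrightarrow> integrable M (\<lambda>\<omega>. (A j \<omega> \<bullet> (x' - x))\<^sup>2)"
  shows "integrable M (\<lambda>\<omega>. log_likelihood_ratio x x' k (past k \<omega>))"
    "expectation (\<lambda>\<omega>. log_likelihood_ratio x x' k (past k \<omega>)) =
      - (\<Sum>j<k. expectation (\<lambda>\<omega>. (A j \<omega> \<bullet> (x' - x))\<^sup>2)) / 2"
proof -
  let ?d = "\<lambda>j \<omega>. A j \<omega> \<bullet> (x' - x)"
  have Wd: "integrable M (\<lambda>\<omega>. ?d j \<omega> * W j \<omega>) \<and> expectation (\<lambda>\<omega>. ?d j \<omega> * W j \<omega>) = 0"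
    if j: "j < k" for j
  proof -
    have jm: "j \<in> measurements l" using j k by auto
    note [measurable] = row_measurable[OF jm]
    have "integrable M (?d j)" by (rule square_integrable_imp_integrable[OF _ int[OF j]]) measurable
    then show ?thesis
      using indep_var_lebesgue_integral[OF indep_var_row_noise[OF jm]] expectation_noise[OF jm]
        indep_var_integrable[OF indep_var_row_noise[OF jm]] by auto
  qed
  show "integrable M (\<lambda>\<omega>. log_likelihood_ratio x x' k (past k \<omega>))"
    using Wd int by (subst Bochner_Integration.integrable_cong[OF refl log_likelihood_ratio_past[OF k]]) auto
  have "expectation (\<lambda>\<omega>. log_likelihood_ratio x x' k (past k \<omega>)) =
      expectation (\<lambda>\<omega>. \<Sum>j<k. ?d j \<omega> * W j \<omega> - (?d j \<omega>)\<^sup>2 / 2)"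
    by (intro Bochner_Integration.integral_cong refl log_likelihood_ratio_past[OF k])
  also have "\<dots> = (\<Sum>j<k. - expectation (\<lambda>\<omega>. (?d j \<omega>)\<^sup>2) / 2)"
    using Wd int by (subst Bochner_Integration.integral_sum) auto
  finally show "expectation (\<lambda>\<omega>. log_likelihood_ratio x x' k (past k \<omega>)) =
      - (\<Sum>j<k. expectation (\<lambda>\<omega>. (?d j \<omega>)\<^sup>2)) / 2"
    by (simp add: sum_negf sum_divide_distrib)
qed

end

text \<open>The condition on the rows says that the Kullback-Leibler divergence of the first law
  from the second is at most \<open>c\<close>. The error under \<open>M'\<close> is moved to
  \<open>M\<close> by \<open>change_of_measure\<close>, which brings the sum into the form of
  \<open>error_sum_ge_exp\<close>.\<close>

lemma finite_data_error_sum_ge_exp: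
  assumes P: "adaptive_sensing M l Q x A W Y" and P': "adaptive_sensing M' l Q x' A' W' Y'"
    and Q: "sensing_strategy l Q" and k: "{..<k} \<subseteq> measurements l"
    and c: "0 \<le> c" "(\<Sum>j<k. \<integral>\<^sup>+\<omega>. ennreal ((A j \<omega> \<bullet> (x' - x))\<^sup>2) \<partial>M) \<le> ennreal (2 * c)"
    and C[measurable]: "C \<in> sets (data_space {..<k})"
  shows "exp (- c) / 2 \<le> measure M {\<omega> \<in> space M. sensing_data {..<k} Y A \<omega> \<in> C} +
    measure M' {\<omega> \<in> space M'. sensing_data {..<k} Y' A' \<omega> \<notin> C}"
proof -
  interpret P: adaptive_sensing M l Q x A W Y by fact
  interpret P': adaptive_sensing M' l Q x' A' W' Y' by fact
  have [measurable]: "P.past k \<in> M \<rightarrow>\<^sub>M data_space {..<k}" "P'.past k \<in> M' \<rightarrow>\<^sub>M data_space {..<k}"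
    using k by (auto intro: P.sensing_data_measurable P'.sensing_data_measurable)
  define Z where "Z \<omega> = log_likelihood_ratio x x' k (P.past k \<omega>)" for \<omega>
  have Zm[measurable]: "Z \<in> borel_measurable M" unfolding Z_def by measurable
  define E where "E = {\<omega> \<in> space M. P.past k \<omega> \<in> C}"
  have E[measurable]: "E \<in> sets M" unfolding E_def by measurable
  have cj: "(\<integral>\<^sup>+\<omega>. ennreal ((A j \<omega> \<bullet> (x' - x))\<^sup>2) \<partial>M) < \<infinity>" if "j < k" for j
  proof -
    have "(\<integral>\<^sup>+\<omega>. ennreal ((A j \<omega> \<bullet> (x' - x))\<^sup>2) \<partial>M) \<le> (\<Sum>j<k. \<integral>\<^sup>+\<omega>. ennreal ((A j \<omega> \<bullet> (x' - x))\<^sup>2) \<partial>M)"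
      using that by (intro member_le_sum) auto
    also note c(2)
    also have "ennreal (2 * c) < \<infinity>" by simp
    finally show ?thesis .
  qed
  have int: "integrable M (\<lambda>\<omega>. (A j \<omega> \<bullet> (x' - x))\<^sup>2)" if "j < k" for j
  proof (rule integrableI_nonneg)
    have [measurable]: "A j \<in> borel_measurable M" using that k P.row_measurable by auto
    show "(\<lambda>\<omega>. (A j \<omega> \<bullet> (x' - x))\<^sup>2) \<in> borel_measurable M" by measurable
  qed (use cj[OF that] in auto)
  have "ennreal (\<Sum>j<k. P.expectation (\<lambda>\<omega>. (A j \<omega> \<bullet> (x' - x))\<^sup>2)) \<le> ennreal (2 * c)"
    using c(2) int by (simp add: nn_integral_eq_integral flip: sum_ennreal)
  then have Z: "integrable M Z" "- c \<le> P.expectation Z"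
    using P.expectation_log_likelihood_ratio[OF k int] c(1) by (auto simp: Z_def[abs_def])
  \<comment> \<open>The change of measure applied to the constant 1: the likelihood ratio has total
    mass 1.\<close>
  have "(\<integral>\<^sup>+\<omega>. exp (Z \<omega>) \<partial>M) = 1"
    using change_of_measure[OF P P' Q k, of "\<lambda>_. 1"] by (simp add: Z_def P'.emeasure_space_1)
  then have eZ: "integrable M (\<lambda>\<omega>. exp (Z \<omega>))" "P.expectation (\<lambda>\<omega>. exp (Z \<omega>)) \<le> 1"
    using nn_integral_eq_integrable[of "\<lambda>\<omega>. exp (Z \<omega>)" M 1] by auto
  have "emeasure M' {\<omega> \<in> space M'. P'.past k \<omega> \<notin> C} = (\<integral>\<^sup>+\<omega>. indicator (- C) (P'.past k \<omega>) \<partial>M')"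
  proof -
    have "{\<omega> \<in> space M'. P'.past k \<omega> \<notin> C} \<in> sets M'" by measurable
    from nn_integral_indicator[OF this, symmetric] show ?thesis
      by (rule trans[OF _ nn_integral_cong]) (auto split: split_indicator)
  qed
  also have "\<dots> = (\<integral>\<^sup>+\<omega>. indicator (- C) (P.past k \<omega>) * ennreal (exp (Z \<omega>)) \<partial>M)"
    unfolding Z_def by (rule change_of_measure[OF P P' Q k]) measurable
  also have "\<dots> = (\<integral>\<^sup>+\<omega>. ennreal (indicator (space M - E) \<omega> * exp (Z \<omega>)) \<partial>M)"
    by (intro nn_integral_cong) (auto simp: E_def split: split_indicator)
  also have "\<dots> = ennreal (\<integral>\<omega>. indicator (space M - E) \<omega> * exp (Z \<omega>) \<partial>M)"
    using eZ by (intro nn_integral_eq_integral)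
      (auto intro!: integrable_real_mult_indicator simp: mult.commute)
  finally have "measure M' {\<omega> \<in> space M'. P'.past k \<omega> \<notin> C} =
      (\<integral>\<omega>. indicator (space M - E) \<omega> * exp (Z \<omega>) \<partial>M)"
    by (simp add: measure_def)
  then show ?thesis
    using P.error_sum_ge_exp[OF Z eZ E] by (simp add: E_def)
qed

section \<open>Infinitely many measurements\<close>

text \<open>The sets that can be approximated for both measures at once form a sigma algebra
  containing \<open>G\<close>: complements keep the symmetric difference, and a countable union is
  first cut off to a finite one at cost below \<open>e / 2\<close>, after which its members are
  approximated one by one.\<close>

lemma sigma_sets_approx_by_algebra:
  assumes N: "finite_measure N" "finite_measure N'" and sets': "sets N' = sets N"
    and G: "algebra (space N) G" and gen: "sets N = sigma_sets (space N) G"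
    and C: "C \<in> sets N" and e: "(e :: real) > 0"
  shows "\<exists>D\<in>G. measure N (sym_diff C D) < e \<and> measure N' (sym_diff C D) < e"
proof -
  interpret N: finite_measure N by fact
  interpret N': finite_measure N' by fact
  interpret G: algebra "space N" G by fact
  have GN: "D \<in> G \<Longrightarrow> D \<in> sets N" for D using gen by auto
  have "C \<in> sigma_sets (space N) G" using C gen by simp
  then show ?thesis using e
  proof (induction arbitrary: e)
    case (Basic a)
    then show ?case by (intro bexI[of _ a]) auto
  next
    case Empty
    then show ?case by (intro bexI[of _ "{}"]) auto
  next
    case (Compl a)
    then obtain D where D: "D \<in> G" "measure N (sym_diff a D) < e" "measure N' (sym_diff a D) < e"
      by blast
    have "a \<subseteq> space N" using Compl.hyps G.space_closed by (rule sigma_sets_into_sp[rotated])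
    then have "sym_diff (space N - a) (space N - D) = sym_diff a D"
      using G.sets_into_space[OF D(1)] by blast
    then show ?case using D by (intro bexI[of _ "space N - D"]) auto
  next
    case (Union a)
    have a: "a i \<in> sets N" for i using Union.hyps gen by auto
    have approx: "\<forall>\<^sub>F n in sequentially. measure L (\<Union>(range a) - (\<Union>i<n. a i)) < e / 2"
      if L: "finite_measure L" and sL: "sets L = sets N" for L
    proof -
      interpret L: finite_measure L by fact
      have aL: "a i \<in> sets L" for i using a sL by simp
      have "(\<lambda>n. measure L (\<Union>i<n. a i)) \<longlonglongrightarrow> measure L (\<Union>n. \<Union>i<n. a i)"
        using aL by (intro L.finite_Lim_measure_incseq) (force simp: incseq_def)+
      also have "(\<Union>n. \<Union>i<n. a i) = \<Union>(range a)" by auto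
      finally have "\<forall>\<^sub>F n in sequentially. measure L (\<Union>(range a)) - e / 2 < measure L (\<Union>i<n. a i)"
        using Union.prems by (intro order_tendstoD(1)) auto
      then show ?thesis
      proof eventually_elim
        case (elim n)
        have "measure L (\<Union>(range a) - (\<Union>i<n. a i)) = measure L (\<Union>(range a)) - measure L (\<Union>i<n. a i)"
          using aL by (intro L.finite_measure_Diff) auto
        then show ?case using elim by simp
      qed
    qed
    \<comment> \<open>Both tails are eventually small, so a single cut-off serves both
      measures.\<close>
    obtain n where n: "measure N (\<Union>(range a) - (\<Union>i<n. a i)) < e / 2"
        "measure N' (\<Union>(range a) - (\<Union>i<n. a i)) < e / 2"
      using eventually_happens'[OF _ eventually_conj[OF approx[OF N(1) refl] approx[OF N(2) sets']]] by auto
    \<comment> \<open>The remaining \<open>e / 2\<close> is shared among the \<open>n\<close>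
      members; the 1 in the denominator keeps \<open>r\<close> positive when
      \<open>n = 0\<close>.\<close>
    define r where "r = e / (2 * (real n + 1))"
    have r: "r > 0" "real n * r \<le> e / 2" using Union.prems by (auto simp: r_def field_simps)
    obtain D where D: "\<And>i. D i \<in> G" "\<And>i. measure N (sym_diff (a i) (D i)) < r"
        "\<And>i. measure N' (sym_diff (a i) (D i)) < r"
      using Union.IH[OF r(1)] by metis
    have "measure L (sym_diff (\<Union>(range a)) (\<Union>i<n. D i)) < e"
      if L: "finite_measure L" and sL: "sets L = sets N"
        and b: "measure L (\<Union>(range a) - (\<Union>i<n. a i)) < e / 2"
        and d: "\<And>i. measure L (sym_diff (a i) (D i)) < r" for L
    proof -
      interpret L: finite_measure L by fact
      have aL: "a i \<in> sets L" "D i \<in> sets L" for i using a D(1) GN sL by auto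
      have "measure L (sym_diff (\<Union>(range a)) (\<Union>i<n. D i))
          \<le> measure L ((\<Union>(range a) - (\<Union>i<n. a i)) \<union> (\<Union>i<n. sym_diff (a i) (D i)))"
        using aL by (intro L.finite_measure_mono) blast+
      also have "\<dots> \<le> measure L (\<Union>(range a) - (\<Union>i<n. a i)) + measure L (\<Union>i<n. sym_diff (a i) (D i))"
        using aL by (intro measure_Un_le) auto
      also have "measure L (\<Union>i<n. sym_diff (a i) (D i)) \<le> (\<Sum>i<n. measure L (sym_diff (a i) (D i)))"
        using aL by (intro L.finite_measure_subadditive_finite) auto
      also have "\<dots> \<le> real n * r"
        using sum_bounded_above[of "{..<n}" "\<lambda>i. measure L (sym_diff (a i) (D i))" r] d
        by (auto intro: less_imp_le)
      finally show ?thesis using b r(2) by linarith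
    qed
    from this[OF N(1) refl n(1) D(2)] this[OF N(2) sets' n(2) D(3)]
    show ?case using D(1) by (intro bexI[of _ "\<Union>i<n. D i"]) auto
  qed
qed

text \<open>Only initial segments are used as bases, so that membership is decided by the first
  \<open>k\<close> measurements and the finite bound applies.\<close>

definition cylinders :: "enat \<Rightarrow> (nat \<Rightarrow> real \<times> (real ^ 'n)) set set" where
  "cylinders l = {prod_emb (measurements l) (\<lambda>_. borel \<Otimes>\<^sub>M borel) {..<k} X | k X.
     {..<k} \<subseteq> measurements l \<and> X \<in> sets (data_space {..<k})}"

lemma algebra_cylinders: "algebra (space (data_space (measurements l))) (cylinders l)"
  unfolding algebra_iff_Int
proof (intro conjI ballI)
  let ?I = "measurements l" and ?B = "\<lambda>_ :: nat. borel \<Otimes>\<^sub>M borel :: (real \<times> (real ^ 'n)) measure"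
  show "cylinders l \<subseteq> Pow (space (data_space ?I))"
    unfolding cylinders_def data_space_def using prod_emb_subset_PiM by blast
  show "{} \<in> cylinders l"
    unfolding cylinders_def by (intro CollectI exI[of _ 0] exI[of _ "{}"]) simp
  fix a :: "(nat \<Rightarrow> real \<times> (real ^ 'n)) set" assume "a \<in> cylinders l"
  then obtain j X where a: "a = prod_emb ?I ?B {..<j} X" and j: "{..<j} \<subseteq> ?I" and X: "X \<in> sets (PiM {..<j} ?B)"
    by (auto simp: cylinders_def data_space_def)
  have "space (data_space ?I) - a = prod_emb ?I ?B {..<j} (space (PiM {..<j} ?B) - X)"
    using j by (simp add: a data_space_def space_PiM prod_emb_PiE)
  then show "space (data_space ?I) - a \<in> cylinders l"
    unfolding cylinders_def data_space_def using j X by blast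
  fix b :: "(nat \<Rightarrow> real \<times> (real ^ 'n)) set" assume "b \<in> cylinders l"
  then obtain k Y where b: "b = prod_emb ?I ?B {..<k} Y" and k: "{..<k} \<subseteq> ?I" and Y: "Y \<in> sets (PiM {..<k} ?B)"
    by (auto simp: cylinders_def data_space_def)
  let ?m = "max j k"
  have m: "{..<?m} \<subseteq> ?I" "{..<j} \<subseteq> {..<?m}" "{..<k} \<subseteq> {..<?m}" using j k by (auto simp: max_def)
  \<comment> \<open>Initial segments are nested, so both bases can be lifted to the longer one and
    intersected there.\<close>
  have "a \<inter> b = prod_emb ?I ?B {..<?m} (prod_emb {..<?m} ?B {..<j} X \<inter> prod_emb {..<?m} ?B {..<k} Y)"
    unfolding prod_emb_Int a b using m by (simp add: prod_emb_trans)
  moreover have "prod_emb {..<?m} ?B {..<j} X \<inter> prod_emb {..<?m} ?B {..<k} Y \<in> sets (PiM {..<?m} ?B)"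
    using m X Y by (intro sets.Int measurable_prod_emb) auto
  ultimately show "a \<inter> b \<in> cylinders l"
    unfolding cylinders_def data_space_def using m(1) by blast
qed

text \<open>Conditions on a single coordinate \<open>i\<close> generate the product sigma algebra,
  and each is a cylinder over \<open>{..<Suc i}\<close>.\<close>

lemma sets_data_space_eq_sigma_cylinders:
  "sets (data_space (measurements l) :: (nat \<Rightarrow> real \<times> (real ^ 'n)) measure) =
     sigma_sets (space (data_space (measurements l))) (cylinders l)"
proof (intro antisym)
  let ?I = "measurements l" and ?B = "\<lambda>_ :: nat. borel \<Otimes>\<^sub>M borel :: (real \<times> (real ^ 'n)) measure"
  show "sigma_sets (space (data_space ?I)) (cylinders l) \<subseteq> sets (data_space ?I :: (nat \<Rightarrow> real \<times> (real ^ 'n)) measure)"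
    by (rule sets.sigma_sets_subset) (auto simp: cylinders_def data_space_def)
  show "sets (data_space ?I :: (nat \<Rightarrow> real \<times> (real ^ 'n)) measure) \<subseteq> sigma_sets (space (data_space ?I)) (cylinders l)"
    unfolding data_space_def sets_PiM_single space_PiM[symmetric]
  proof (intro sigma_sets_mono', safe)
    fix i and C :: "(real \<times> (real ^ 'n)) set" assume i: "i \<in> ?I" and C: "C \<in> sets (borel \<Otimes>\<^sub>M borel)"
    have sub: "{..<Suc i} \<subseteq> ?I" using measurements_downward[OF i] by (simp add: lessThan_Suc_atMost)
    let ?X = "{f \<in> space (PiM {..<Suc i} ?B). f i \<in> C}"
    have "?X \<in> sets (PiM {..<Suc i} ?B)" using C by measurable
    moreover have "{f \<in> space (PiM ?I ?B). f i \<in> C} = prod_emb ?I ?B {..<Suc i} ?X"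
      using sub by (auto simp: prod_emb_iff space_PiM PiE_iff space_pair_measure)
    ultimately show "{f \<in> space (PiM ?I ?B). f i \<in> C} \<in> cylinders l"
      unfolding cylinders_def data_space_def using sub by blast
  qed
qed

text \<open>The test set \<open>C\<close> is replaced by a cylinder \<open>B\<close> that is close
  to it under both laws of the data. The finite bound applies to \<open>B\<close>, returning to
  \<open>C\<close> costs at most \<open>e / 2\<close> in each error probability, and
  \<open>e\<close> is arbitrary.\<close>

lemma data_error_sum_ge_exp:
  assumes P: "adaptive_sensing M l Q x A W Y" and P': "adaptive_sensing M' l Q x' A' W' Y'"
    and Q: "sensing_strategy l Q"
    and c: "0 \<le> c" "(\<integral>\<^sup>+\<omega>. (\<Sum>k. if k \<in> measurements l then ennreal ((A k \<omega> \<bullet> (x' - x))\<^sup>2) else 0) \<partial>M) \<le> ennreal (2 * c)"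
    and C: "C \<in> sets (data_space (measurements l))"
  shows "exp (- c) / 2 \<le> measure M {\<omega> \<in> space M. sensing_data (measurements l) Y A \<omega> \<in> C} +
    measure M' {\<omega> \<in> space M'. sensing_data (measurements l) Y' A' \<omega> \<notin> C}"
proof (rule field_le_epsilon)
  fix e :: real assume "e > 0"
  then have e: "e / 2 > 0" by simp
  interpret P: adaptive_sensing M l Q x A W Y by fact
  interpret P': adaptive_sensing M' l Q x' A' W' Y' by fact
  let ?I = "measurements l"
  let ?D = "sensing_data ?I Y A" and ?D' = "sensing_data ?I Y' A'"
  let ?S = "data_space ?I :: (nat \<Rightarrow> real \<times> (real ^ 'b)) measure"
  have D[measurable]: "?D \<in> M \<rightarrow>\<^sub>M ?S" "?D' \<in> M' \<rightarrow>\<^sub>M ?S"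
    by (auto intro: P.sensing_data_measurable P'.sensing_data_measurable)
  let ?N = "distr M ?S ?D" and ?N' = "distr M' ?S ?D'"
  interpret N: prob_space ?N by (rule P.prob_space_distr) measurable
  interpret N': prob_space ?N' by (rule P'.prob_space_distr) measurable
  obtain B where B: "B \<in> cylinders l" "measure ?N (sym_diff C B) < e / 2" "measure ?N' (sym_diff C B) < e / 2"
    using sigma_sets_approx_by_algebra[OF N.finite_measure_axioms N'.finite_measure_axioms, of "cylinders l" C, OF _ _ _ _ e]
      algebra_cylinders[of l] sets_data_space_eq_sigma_cylinders[of l] C by auto
  obtain k X where BX: "B = prod_emb ?I (\<lambda>_. borel \<Otimes>\<^sub>M borel) {..<k} X"
    and k: "{..<k} \<subseteq> ?I" and X: "X \<in> sets (data_space {..<k})"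
    using B(1) by (auto simp: cylinders_def)
  have [measurable]: "C \<in> sets ?S" "B \<in> sets ?S"
    using C B(1) sets_data_space_eq_sigma_cylinders[of l] by auto
  \<comment> \<open>Testing the first \<open>k\<close> measurements with \<open>X\<close> is the
    same as testing the full data with the cylinder \<open>B\<close>.\<close>
  have past: "sensing_data {..<k} Y A \<omega> \<in> X \<longleftrightarrow> ?D \<omega> \<in> B"
    "sensing_data {..<k} Y' A' \<omega>' \<in> X \<longleftrightarrow> ?D' \<omega>' \<in> B" for \<omega> \<omega>'
    using k by (auto simp: BX prod_emb_iff sensing_data_def space_pair_measure Int_absorb1 restrict_restrict)
  have "(\<Sum>j<k. \<integral>\<^sup>+\<omega>. ennreal ((A j \<omega> \<bullet> (x' - x))\<^sup>2) \<partial>M) = (\<integral>\<^sup>+\<omega>. (\<Sum>j<k. ennreal ((A j \<omega> \<bullet> (x' - x))\<^sup>2)) \<partial>M)"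
  proof (rule nn_integral_sum[symmetric])
    fix j assume "j \<in> {..<k}"
    then have [measurable]: "A j \<in> borel_measurable M" using k P.row_measurable by auto
    show "(\<lambda>\<omega>. ennreal ((A j \<omega> \<bullet> (x' - x))\<^sup>2)) \<in> borel_measurable M" by measurable
  qed
  also have "\<dots> \<le> (\<integral>\<^sup>+\<omega>. (\<Sum>k. if k \<in> ?I then ennreal ((A k \<omega> \<bullet> (x' - x))\<^sup>2) else 0) \<partial>M)"
  proof (rule nn_integral_mono)
    fix \<omega>
    have "(\<Sum>j<k. ennreal ((A j \<omega> \<bullet> (x' - x))\<^sup>2)) = (\<Sum>j<k. if j \<in> ?I then ennreal ((A j \<omega> \<bullet> (x' - x))\<^sup>2) else 0)"
      using k by (intro sum.cong) auto
    also have "\<dots> \<le> (\<Sum>k. if k \<in> ?I then ennreal ((A k \<omega> \<bullet> (x' - x))\<^sup>2) else 0)"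
      by (rule sum_le_suminf) auto
    finally show "(\<Sum>j<k. ennreal ((A j \<omega> \<bullet> (x' - x))\<^sup>2)) \<le> (\<Sum>k. if k \<in> ?I then ennreal ((A k \<omega> \<bullet> (x' - x))\<^sup>2) else 0)" .
  qed
  also note c(2)
  finally have "exp (- c) / 2 \<le> measure M {\<omega> \<in> space M. ?D \<omega> \<in> B} + measure M' {\<omega> \<in> space M'. ?D' \<omega> \<notin> B}"
    using finite_data_error_sum_ge_exp[OF P P' Q k c(1) _ X] by (simp add: past)
  also have "measure M {\<omega> \<in> space M. ?D \<omega> \<in> B} \<le> measure M {\<omega> \<in> space M. ?D \<omega> \<in> C} + e / 2"
  proof -
    have "measure ?N B \<le> measure ?N (C \<union> sym_diff C B)"
      by (intro N.finite_measure_mono) auto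
    also have "\<dots> \<le> measure ?N C + measure ?N (sym_diff C B)"
      by (intro measure_Un_le) auto
    finally show ?thesis using B(2) by (simp add: measure_distr vimage_def Int_def conj_commute)
  qed
  also have "measure M' {\<omega> \<in> space M'. ?D' \<omega> \<notin> B} \<le> measure M' {\<omega> \<in> space M'. ?D' \<omega> \<notin> C} + e / 2"
  proof -
    have sp: "?D' \<omega> \<in> space ?S" if "\<omega> \<in> space M'" for \<omega> using D(2) that by (rule measurable_space)
    have eq: "{\<omega> \<in> space M'. ?D' \<omega> \<notin> E} = ?D' -` (space ?S - E) \<inter> space M'" for E using sp by auto
    have "measure ?N' (space ?S - B) \<le> measure ?N' ((space ?S - C) \<union> sym_diff C B)"
      by (intro N'.finite_measure_mono) auto
    also have "\<dots> \<le> measure ?N' (space ?S - C) + measure ?N' (sym_diff C B)"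
      by (intro measure_Un_le) auto
    finally show ?thesis using B(3) by (simp add: measure_distr eq)
  qed
  finally show "exp (- c) / 2 \<le> measure M {\<omega> \<in> space M. ?D \<omega> \<in> C} + measure M' {\<omega> \<in> space M'. ?D' \<omega> \<notin> C} + e"
    by simp
qed

section \<open>Neighbouring supports\<close>

definition flip :: "'a \<Rightarrow> 'a set \<Rightarrow> 'a set" where
  "flip i S = (if i \<in> S then S - {i} else insert i S)"

lemma flip_flip[simp]: "flip i (flip i S) = S"
  by (auto simp: flip_def)

lemma mem_flip_iff[simp]: "i \<in> flip i S \<longleftrightarrow> i \<notin> S"
  by (auto simp: flip_def)

lemma card_flip: "finite S \<Longrightarrow> card (flip i S) = (if i \<in> S then card S - 1 else card S + 1)"
  by (auto simp: flip_def)

text \<open>Toggling \<open>i\<close> is an involution, so the map from \<open>(S, i)\<close> to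
  \<open>(flip i S, i)\<close> is injective. Its image lies among the pairs whose first component
  has size \<open>s + 1\<close> or \<open>s - 1\<close>; as \<open>e\<close> is nonnegative, the sum
  may be extended to all of these.\<close>

lemma sum_flip_le:
  fixes e :: "'n::finite set \<Rightarrow> 'n \<Rightarrow> real"
  assumes e: "\<And>S i. 0 \<le> e S i" and s: "1 \<le> s"
    and b: "\<And>T. card T = s + 1 \<or> card T = s - 1 \<Longrightarrow> (\<Sum>i\<in>UNIV. e T i) \<le> b"
  shows "(\<Sum>S | card S = s. \<Sum>i\<in>UNIV. e (flip i S) i) \<le>
    real ((CARD('n) choose (s + 1)) + (CARD('n) choose (s - 1))) * b"
proof -
  let ?T = "{T :: 'n set. card T = s + 1} \<union> {T. card T = s - 1}"
  have inj: "inj_on (\<lambda>(S, i). (flip i S, i)) ({S :: 'n set. card S = s} \<times> UNIV)"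
    by (rule inj_on_inverseI[of _ "\<lambda>(S, i). (flip i S, i)"]) auto
  have "(\<Sum>S | card S = s. \<Sum>i\<in>UNIV. e (flip i S) i) =
      (\<Sum>(T, i)\<in>(\<lambda>(S, i). (flip i S, i)) ` ({S. card S = s} \<times> UNIV). e T i)"
    by (subst sum.reindex[OF inj]) (simp add: sum.cartesian_product split_beta)
  also have "\<dots> \<le> (\<Sum>(T, i)\<in>?T \<times> UNIV. e T i)"
    using e by (intro sum_mono2) (auto simp: card_flip)
  also have "\<dots> = (\<Sum>T\<in>?T. \<Sum>i\<in>UNIV. e T i)"
    by (simp add: sum.cartesian_product)
  also have "\<dots> \<le> real (card ?T) * b"
    using b by (intro sum_bounded_above) auto
  also have "card ?T = (CARD('n) choose (s + 1)) + (CARD('n) choose (s - 1))"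
    using n_subsets[of "UNIV :: 'n set"] s by (subst card_Un_disjoint) auto
  finally show ?thesis .
qed

text \<open>Relative to \<open>n choose s\<close>, the upper neighbour is
  \<open>(n - s) / (s + 1)\<close> and the lower one \<open>s / (n - s + 1)\<close>. The right side
  is chosen to produce the factor \<open>s * (n - s) / (n + 1)\<close> inside the final
  logarithm.\<close>

lemma binomial_neighbours_le:
  assumes "1 \<le> s" "s < n"
  shows "real (n choose s) + real (n choose (s + 1)) + real (n choose (s - 1)) \<le>
    real (n choose s) * (real n * (real n + 1) / (real s * (real n - real s)))"
proof -
  obtain t where s: "s = Suc t" using assms by (cases s) auto
  have up: "(real s + 1) * real (n choose (s + 1)) = (real n - real s) * real (n choose s)"
    using binomial_absorption[of s n] binomial_absorb_comp[of n s] assms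
    by (metis Suc_eq_plus1 less_imp_le_nat of_nat_Suc of_nat_diff of_nat_mult add.commute)
  have down: "real s * real (n choose s) = (real n - real s + 1) * real (n choose (s - 1))"
  proof -
    have "Suc t * (n choose Suc t) = (n - t) * (n choose t)"
      using binomial_absorption[of t n] binomial_absorb_comp[of n t] by simp
    then have "real (Suc t * (n choose Suc t)) = real ((n - t) * (n choose t))" by simp
    then show ?thesis using assms by (simp add: s of_nat_diff algebra_simps del: binomial_Suc_Suc)
  qed
  define B where "B = real (n choose s)"
  have B: "B \<ge> 0" by (simp add: B_def)
  have pos: "real s > 0" "real n - real s > 0" using assms by auto
  have "real (n choose (s + 1)) = B * ((real n - real s) / (real s + 1))"
    using up pos by (simp add: B_def field_simps)
  moreover have "real (n choose (s - 1)) = B * (real s / (real n - real s + 1))"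
    using down pos by (simp add: B_def field_simps)
  ultimately have "real (n choose s) + real (n choose (s + 1)) + real (n choose (s - 1)) =
      B * ((1 + (real n - real s) / (real s + 1)) + real s / (real n - real s + 1))"
    by (simp add: B_def algebra_simps)
  \<comment> \<open>A deliberately loose estimate: with denominators \<open>s\<close> and
    \<open>n - s\<close> and numerators \<open>n + 1\<close> the two fractions add up to a single
    closed expression.\<close>
  also have "\<dots> \<le> B * ((real n + 1) / real s + (real n + 1) / (real n - real s))"
  proof (intro mult_left_mono add_mono B)
    have "1 + (real n - real s) / (real s + 1) = (real n + 1) / (real s + 1)"
      by (simp add: field_simps)
    also have "\<dots> \<le> (real n + 1) / real s" using pos by (intro divide_left_mono) auto
    finally show "1 + (real n - real s) / (real s + 1) \<le> (real n + 1) / real s" .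
    show "real s / (real n - real s + 1) \<le> (real n + 1) / (real n - real s)"
      using pos by (intro frac_le) auto
  qed
  also have "(real n + 1) / real s + (real n + 1) / (real n - real s) = real n * (real n + 1) / (real s * (real n - real s))"
    using pos by (simp add: field_simps)
  finally show ?thesis by (simp add: B_def)
qed

text \<open>Jensen's inequality in tangent form: \<open>exp\<close> lies above its tangent at
  \<open>- c\<close>, and the linear terms add up to something nonnegative by the bound on the sum
  of the \<open>b i\<close>.\<close>

lemma sum_exp_ge:
  fixes b :: "'i \<Rightarrow> real"
  assumes "(\<Sum>i\<in>I. b i) \<le> real (card I) * c"
  shows "real (card I) * exp (- c) \<le> (\<Sum>i\<in>I. exp (- b i))"
proof -
  have "exp (- c) * (1 + (c - b i)) \<le> exp (- b i)" for i
    using mult_left_mono[OF exp_ge_add_one_self[of "c - b i"], of "exp (- c)"]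
    by (simp flip: exp_add)
  then have "(\<Sum>i\<in>I. exp (- c) * (1 + (c - b i))) \<le> (\<Sum>i\<in>I. exp (- b i))" by (intro sum_mono)
  moreover have "(\<Sum>i\<in>I. exp (- c) * (1 + (c - b i))) = exp (- c) * (real (card I) + (real (card I) * c - (\<Sum>i\<in>I. b i)))"
    by (simp add: sum.distrib sum_subtractf flip: sum_distrib_left)
  moreover have "exp (- c) * real (card I) \<le> exp (- c) * (real (card I) + (real (card I) * c - (\<Sum>i\<in>I. b i)))"
    using assms by (intro mult_left_mono) auto
  ultimately show ?thesis by (simp only: mult.commute[of "real (card I)" "exp (- c)"])
qed

section \<open>Flat signals, column energies and coordinate errors\<close>

definition flat_signal :: "real \<Rightarrow> 'n set \<Rightarrow> real ^ 'n" where
  "flat_signal \<mu> S = (\<chi> i. if i \<in> S then \<mu> else 0)"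

lemma supp_flat_signal: "\<mu> \<noteq> 0 \<Longrightarrow> supp (flat_signal \<mu> S) = S"
  by (auto simp: supp_def flat_signal_def)

lemma flat_signal_in_signal_class:
  assumes "\<mu> > 0" "S \<in> support_class s" shows "flat_signal \<mu> S \<in> signal_class s \<mu>"
  using assms supp_flat_signal[of \<mu> S]
  by (auto simp: signal_class_def intro!: INF_greatest) (simp add: flat_signal_def)

text \<open>The two signals differ in coordinate \<open>i\<close> only, by \<mu> or its negative;
  the square removes the sign, so adding and deleting a coordinate are treated alike.\<close>

lemma inner_flat_signal_flip_diff:
  "(a \<bullet> (flat_signal \<mu> (flip i S) - flat_signal \<mu> S))\<^sup>2 = \<mu>\<^sup>2 * (a $ i)\<^sup>2"
proof -
  have "flat_signal \<mu> (flip i S) - flat_signal \<mu> S = axis i (if i \<in> S then - \<mu> else \<mu>)"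
    by (auto simp: vec_eq_iff flat_signal_def flip_def axis_def)
  then show ?thesis by (simp add: inner_axis power_mult_distrib)
qed

text \<open>Splits the budget into the expected energies of the columns. All terms are nonnegative,
  so sums and integral may be exchanged.\<close>

lemma sum_nn_integral_frobenius_sq:
  fixes A :: "nat \<Rightarrow> 'a \<Rightarrow> real ^ 'n"
  assumes "\<And>k. k \<in> measurements l \<Longrightarrow> A k \<in> borel_measurable M"
  shows "(\<Sum>i\<in>UNIV. \<integral>\<^sup>+\<omega>. (\<Sum>k. if k \<in> measurements l then ennreal ((A k \<omega> $ i)\<^sup>2) else 0) \<partial>M) =
    (\<integral>\<^sup>+\<omega>. frobenius_sq l A \<omega> \<partial>M)"
proof -
  have "(\<lambda>\<omega>. if k \<in> measurements l then ennreal ((A k \<omega> $ i)\<^sup>2) else 0) \<in> borel_measurable M" for k i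
    using measurable_compose[OF assms borel_measurable_real_vec] by (cases "k \<in> measurements l") auto
  then have "(\<Sum>i\<in>UNIV. \<integral>\<^sup>+\<omega>. (\<Sum>k. if k \<in> measurements l then ennreal ((A k \<omega> $ i)\<^sup>2) else 0) \<partial>M) =
      (\<integral>\<^sup>+\<omega>. (\<Sum>i\<in>UNIV. \<Sum>k. if k \<in> measurements l then ennreal ((A k \<omega> $ i)\<^sup>2) else 0) \<partial>M)"
    by (intro nn_integral_sum[symmetric] borel_measurable_suminf_order)
  also have "\<dots> = (\<integral>\<^sup>+\<omega>. frobenius_sq l A \<omega> \<partial>M)"
    unfolding frobenius_sq_def
    by (intro nn_integral_cong, subst suminf_sum[symmetric]) (auto intro!: suminf_cong)
  finally show ?thesis .
qed

definition coordinate_error ::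
    "'a measure \<Rightarrow> ('a \<Rightarrow> nat \<Rightarrow> real \<times> (real ^ 'n)) \<Rightarrow>
     ((nat \<Rightarrow> real \<times> (real ^ 'n)) \<Rightarrow> 'n set) \<Rightarrow> 'n set \<Rightarrow> 'n \<Rightarrow> real" where
  "coordinate_error M D S_hat S i = measure M {\<omega> \<in> space M. (i \<in> S_hat (D \<omega>)) \<noteq> (i \<in> S)}"

text \<open>The size of the symmetric difference counts the coordinates whose membership is decided
  wrongly, so the risk decouples into one testing problem per coordinate.\<close>

lemma sum_coordinate_error:
  fixes S :: "'n::finite set"
  assumes "prob_space M" and D: "D \<in> M \<rightarrow>\<^sub>M N" "S_hat \<in> N \<rightarrow>\<^sub>M count_space UNIV"
  shows "ennreal (\<Sum>i\<in>UNIV. coordinate_error M D S_hat S i) =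
    (\<integral>\<^sup>+\<omega>. of_nat (support_dist (S_hat (D \<omega>)) S) \<partial>M)"
proof -
  interpret prob_space M by fact
  note D[measurable]
  have E[measurable]: "{\<omega> \<in> space M. (i \<in> S_hat (D \<omega>)) \<noteq> (i \<in> S)} \<in> sets M" for i by measurable
  have "ennreal (\<Sum>i\<in>UNIV. coordinate_error M D S_hat S i) =
      (\<Sum>i\<in>UNIV. emeasure M {\<omega> \<in> space M. (i \<in> S_hat (D \<omega>)) \<noteq> (i \<in> S)})"
    unfolding coordinate_error_def emeasure_eq_measure by (rule sum_ennreal[symmetric]) simp
  also have "\<dots> = (\<integral>\<^sup>+\<omega>. (\<Sum>i\<in>UNIV. indicator {\<omega> \<in> space M. (i \<in> S_hat (D \<omega>)) \<noteq> (i \<in> S)} \<omega>) \<partial>M)"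
    by (subst nn_integral_sum) (auto simp: E)
  also have "\<dots> = (\<integral>\<^sup>+\<omega>. of_nat (support_dist (S_hat (D \<omega>)) S) \<partial>M)"
  proof (rule nn_integral_cong)
    have card: "(\<Sum>i\<in>UNIV. indicator B i :: ennreal) = of_nat (card B)" for B :: "'n set"
      by (simp add: indicator_def)
    fix \<omega> assume "\<omega> \<in> space M"
    then have "(\<Sum>i\<in>UNIV. indicator {\<omega> \<in> space M. (i \<in> S_hat (D \<omega>)) \<noteq> (i \<in> S)} \<omega>) =
        (\<Sum>i\<in>UNIV. indicator (sym_diff (S_hat (D \<omega>)) S) i :: ennreal)"
      by (intro sum.cong) (auto split: split_indicator)
    then show "(\<Sum>i\<in>UNIV. indicator {\<omega> \<in> space M. (i \<in> S_hat (D \<omega>)) \<noteq> (i \<in> S)} \<omega> :: ennreal) =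
        of_nat (support_dist (S_hat (D \<omega>)) S)"
      by (simp only: support_dist_def card)
  qed
  finally show ?thesis .
qed

text \<open>The decision of the estimator about \<open>i\<close> is a test between \<open>S\<close>
  and \<open>flip i S\<close>. On \<open>?C\<close> it is wrong for \<open>S\<close>; off
  \<open>?C\<close> it is wrong for the flipped set, which has the opposite membership of
  \<open>i\<close>. The divergence involves only the energy of column \<open>i\<close> under
  \<open>S\<close>.\<close>

lemma coordinate_error_flip_ge:
  fixes S :: "'n::finite set"
  assumes P: "adaptive_sensing M l Q (flat_signal \<mu> S) A W Y"
    and P': "adaptive_sensing M' l Q (flat_signal \<mu> (flip i S)) A' W' Y'"
    and Q: "sensing_strategy l Q" and c: "0 \<le> c"
    and cost: "ennreal (\<mu>\<^sup>2) * (\<integral>\<^sup>+\<omega>. (\<Sum>k. if k \<in> measurements l then ennreal ((A k \<omega> $ i)\<^sup>2) else 0) \<partial>M) \<le> ennreal (2 * c)"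
    and S_hat: "S_hat \<in> data_space (measurements l) \<rightarrow>\<^sub>M count_space UNIV"
  shows "exp (- c) / 2 \<le> coordinate_error M (sensing_data (measurements l) Y A) S_hat S i +
    coordinate_error M' (sensing_data (measurements l) Y' A') S_hat (flip i S) i"
proof -
  interpret P: adaptive_sensing M l Q "flat_signal \<mu> S" A W Y by fact
  interpret P': adaptive_sensing M' l Q "flat_signal \<mu> (flip i S)" A' W' Y' by fact
  let ?I = "measurements l"
  let ?C = "{h \<in> space (data_space ?I). (i \<in> S_hat h) \<noteq> (i \<in> S)}"
  note S_hat[measurable]
  have C: "?C \<in> sets (data_space ?I)" by measurable
  have D: "sensing_data ?I Y A \<omega> \<in> space (data_space ?I)" if "\<omega> \<in> space M" for \<omega>
    by (rule measurable_space[OF P.sensing_data_measurable[OF order_refl] that])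
  have D': "sensing_data ?I Y' A' \<omega> \<in> space (data_space ?I)" if "\<omega> \<in> space M'" for \<omega>
    by (rule measurable_space[OF P'.sensing_data_measurable[OF order_refl] that])
  have [measurable]: "(\<lambda>\<omega>. if k \<in> ?I then ennreal ((A k \<omega> $ i)\<^sup>2) else 0) \<in> borel_measurable M" for k
    using measurable_compose[OF P.row_measurable borel_measurable_real_vec, of k i] by (cases "k \<in> ?I") auto
  have "(\<integral>\<^sup>+\<omega>. (\<Sum>k. if k \<in> ?I then ennreal ((A k \<omega> \<bullet> (flat_signal \<mu> (flip i S) - flat_signal \<mu> S))\<^sup>2) else 0) \<partial>M) =
      (\<integral>\<^sup>+\<omega>. (\<Sum>k. ennreal (\<mu>\<^sup>2) * (if k \<in> ?I then ennreal ((A k \<omega> $ i)\<^sup>2) else 0)) \<partial>M)"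
    unfolding inner_flat_signal_flip_diff
    by (intro nn_integral_cong suminf_cong) (auto simp: ennreal_mult)
  also have "\<dots> = ennreal (\<mu>\<^sup>2) * (\<integral>\<^sup>+\<omega>. (\<Sum>k. if k \<in> ?I then ennreal ((A k \<omega> $ i)\<^sup>2) else 0) \<partial>M)"
    by (simp add: ennreal_suminf_cmult nn_integral_cmult)
  also note cost
  finally have "exp (- c) / 2 \<le> measure M {\<omega> \<in> space M. sensing_data ?I Y A \<omega> \<in> ?C} +
      measure M' {\<omega> \<in> space M'. sensing_data ?I Y' A' \<omega> \<notin> ?C}"
    by (rule data_error_sum_ge_exp[OF P P' Q c _ C])
  also have "{\<omega> \<in> space M. sensing_data ?I Y A \<omega> \<in> ?C} =
      {\<omega> \<in> space M. (i \<in> S_hat (sensing_data ?I Y A \<omega>)) \<noteq> (i \<in> S)}"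
    using D by auto
  also have "{\<omega> \<in> space M'. sensing_data ?I Y' A' \<omega> \<notin> ?C} =
      {\<omega> \<in> space M'. (i \<in> S_hat (sensing_data ?I Y' A' \<omega>)) \<noteq> (i \<in> flip i S)}"
    using D' by auto
  finally show ?thesis by (simp only: coordinate_error_def)
qed

section \<open>The lower bound on the signal magnitude\<close>

(* sqrt is negative at negative arguments, so the bound is vacuous there, as \<mu> > 0. *)
theorem proposition4p2:
  fixes n s :: nat and l :: enat and m \<mu> \<epsilon> :: real
    and Q :: "nat \<Rightarrow> (nat \<Rightarrow> real \<times> (real ^ 'n)) \<Rightarrow> (real ^ 'n) measure"
    and M :: "real ^ 'n \<Rightarrow> 'a measure"
    and A :: "real ^ 'n \<Rightarrow> nat \<Rightarrow> 'a \<Rightarrow> real ^ 'n"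
    and W Y :: "real ^ 'n \<Rightarrow> nat \<Rightarrow> 'a \<Rightarrow> real"
    and S_hat :: "(nat \<Rightarrow> real \<times> (real ^ 'n)) \<Rightarrow> 'n set"
  assumes "n = CARD('n)" and "n \<ge> 2" and "1 \<le> s" and "s \<le> n - 1" and "m > 0" and "\<mu> > 0"
    and "sensing_strategy l Q"
    and "\<And>x. x \<in> signal_class s \<mu> \<Longrightarrow> adaptive_sensing (M x) l Q x (A x) (W x) (Y x)"
    and "\<And>x. x \<in> signal_class s \<mu> \<Longrightarrow> (\<integral>\<^sup>+\<omega>. frobenius_sq l (A x) \<omega> \<partial>M x) \<le> ennreal m"
    and "S_hat \<in> data_space (measurements l) \<rightarrow>\<^sub>M count_space UNIV"
    and "0 < \<epsilon>" and "\<epsilon> < 1"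
    and "(SUP x\<in>signal_class s \<mu>.
            \<integral>\<^sup>+\<omega>. of_nat (support_dist (S_hat (sensing_data (measurements l) (Y x) (A x) \<omega>)) (supp x)) \<partial>M x)
          \<le> ennreal \<epsilon>"
  shows "\<mu> \<ge> sqrt (2 * real n / m *
           (ln (real s) + ln ((real n - real s) / (real n + 1)) + ln (1 / (2 * \<epsilon>))))"
proof -
  note n = assms(1) and s = assms(3,4) and m = assms(5) and \<mu> = assms(6) and Q = assms(7)
    and P = assms(8) and budget = assms(9) and S_hat = assms(10) and \<epsilon> = assms(11) and risk = assms(13)
  let ?I = "measurements l"
  let ?x = "flat_signal \<mu> :: 'n set \<Rightarrow> real ^ 'n"
  have x: "?x S \<in> signal_class s \<mu>" if "S \<in> support_class s" for S
    using flat_signal_in_signal_class[OF \<mu> that] .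
  define e where "e S i = coordinate_error (M (?x S)) (sensing_data ?I (Y (?x S)) (A (?x S))) S_hat S i" for S i
  \<comment> \<open>The divergence for one flip when the budget is spread evenly over all
    \<open>n\<close> columns.\<close>
  define c where "c = \<mu>\<^sup>2 * m / (2 * real n)"
  define N where "N = real (n choose s)"
  have n0: "real n > 0" "real s > 0" "real n - real s > 0" "s < n" using s assms(2) by auto
  \<comment> \<open>By \<open>binomial_neighbours_le\<close>, \<open>n * K\<close> bounds the number
    of all supports in the class relative to the number of those of size \<open>s\<close>.\<close>
  define K where "K = (real n + 1) / (real s * (real n - real s))"
  have N: "N > 0" and K: "K > 0" using n0 by (simp_all add: N_def K_def)

  have e_sum: "(\<Sum>i\<in>UNIV. e S i) \<le> \<epsilon>" if S: "S \<in> support_class s" for S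
  proof -
    interpret P: adaptive_sensing "M (?x S)" l Q "?x S" "A (?x S)" "W (?x S)" "Y (?x S)"
      by (rule P[OF x[OF S]])
    have "ennreal (\<Sum>i\<in>UNIV. e S i) =
        (\<integral>\<^sup>+\<omega>. of_nat (support_dist (S_hat (sensing_data ?I (Y (?x S)) (A (?x S)) \<omega>)) (supp (?x S))) \<partial>M (?x S))"
      unfolding e_def
      using sum_coordinate_error[OF P.prob_space_axioms P.sensing_data_measurable[OF order_refl] S_hat] \<mu>
      by (simp add: supp_flat_signal)
    also have "\<dots> \<le> ennreal \<epsilon>"
      by (rule order_trans[OF SUP_upper risk]) (rule x[OF S])
    finally show ?thesis using \<epsilon> by (simp add: ennreal_le_iff)
  qed

  have lower: "real n * exp (- c) / 2 \<le> (\<Sum>i\<in>UNIV. e S i) + (\<Sum>i\<in>UNIV. e (flip i S) i)"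
    if S: "card S = s" for S
  proof -
    have Sc: "S \<in> support_class s" and fl: "flip i S \<in> support_class s" for i
      using S by (auto simp: support_class_def card_flip)
    interpret P: adaptive_sensing "M (?x S)" l Q "?x S" "A (?x S)" "W (?x S)" "Y (?x S)"
      by (rule P[OF x[OF Sc]])
    let ?b = "\<lambda>i. \<integral>\<^sup>+\<omega>. (\<Sum>k. if k \<in> ?I then ennreal ((A (?x S) k \<omega> $ i)\<^sup>2) else 0) \<partial>M (?x S)"
    have total: "(\<Sum>i\<in>UNIV. ?b i) \<le> ennreal m"
      using budget[OF x[OF Sc]] sum_nn_integral_frobenius_sq[OF P.row_measurable] by simp
    have "?b i \<le> (\<Sum>i\<in>UNIV. ?b i)" for i by (rule member_le_sum) auto
    \<comment> \<open>Each column energy is finite because their sum is at most \<open>m\<close>;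
      this allows passing to the real numbers \<open>b i\<close>.\<close>
    from le_less_trans[OF order_trans[OF this total] ennreal_less_top] have "?b i < \<infinity>" for i
      by simp
    moreover define b where "b i = enn2real (?b i)" for i
    ultimately have b: "0 \<le> b i" "?b i = ennreal (b i)" for i
      by (simp_all add: less_top)
    have "(\<Sum>i\<in>UNIV. b i) \<le> m"
      using total m b(1) by (simp add: b(2) ennreal_le_iff)
    \<comment> \<open>The average divergence over the \<open>n\<close> flips is at most
      \<open>c\<close>, although the design may favour some columns.\<close>
    then have "(\<Sum>i\<in>UNIV. \<mu>\<^sup>2 * b i / 2) \<le> real (card (UNIV :: 'n set)) * c"
      using n0 \<mu> by (simp add: c_def n flip: sum_divide_distrib sum_distrib_left)
    then have "real n * exp (- c) / 2 \<le> (\<Sum>i\<in>UNIV. exp (- (\<mu>\<^sup>2 * b i / 2)) / 2)"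
      using sum_exp_ge[of "\<lambda>i. \<mu>\<^sup>2 * b i / 2" UNIV c] by (simp add: n flip: sum_divide_distrib)
    also have "\<dots> \<le> (\<Sum>i\<in>UNIV. e S i + e (flip i S) i)"
      unfolding e_def
    proof (intro sum_mono coordinate_error_flip_ge[OF P[OF x[OF Sc]] P[OF x[OF fl]] Q _ _ S_hat])
      fix i
      show "0 \<le> \<mu>\<^sup>2 * b i / 2" using b(1)[of i] by simp
      show "ennreal (\<mu>\<^sup>2) * ?b i \<le> ennreal (2 * (\<mu>\<^sup>2 * b i / 2))"
        using b(1)[of i] by (simp add: b(2) ennreal_mult)
    qed
    finally show ?thesis by (simp add: sum.distrib)
  qed

  have cardS: "real (card {S :: 'n set. card S = s}) = N"
    using n_subsets[of "UNIV :: 'n set" s] by (simp add: N_def n)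
  have "N * (real n * exp (- c) / 2) = (\<Sum>S | card (S :: 'n set) = s. real n * exp (- c) / 2)"
    by (simp add: cardS)
  also have "\<dots> \<le> (\<Sum>S | card S = s. \<Sum>i\<in>UNIV. e S i) + (\<Sum>S | card S = s. \<Sum>i\<in>UNIV. e (flip i S) i)"
    unfolding sum.distrib[symmetric] by (intro sum_mono) (use lower in \<open>auto simp: sum.distrib\<close>)
  also have "(\<Sum>S | card S = s. \<Sum>i\<in>UNIV. e S i) \<le> N * \<epsilon>"
    using sum_bounded_above[of "{S. card S = s}" "\<lambda>S. \<Sum>i\<in>UNIV. e S i" \<epsilon>] e_sum cardS
    by (auto simp: support_class_def)
  \<comment> \<open>Here the risk bound is used at supports of size \<open>s + 1\<close> and
    \<open>s - 1\<close>; the previous sum used it at size \<open>s\<close>.\<close>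
  also have "(\<Sum>S | card S = s. \<Sum>i\<in>UNIV. e (flip i S) i) \<le>
      real ((n choose (s + 1)) + (n choose (s - 1))) * \<epsilon>"
    unfolding n using s(1) e_sum
    by (intro sum_flip_le) (auto simp: e_def coordinate_error_def support_class_def)
  finally have "N * (real n * exp (- c) / 2) \<le> (N + real (n choose (s + 1)) + real (n choose (s - 1))) * \<epsilon>"
    by (simp add: algebra_simps)
  also have "\<dots> \<le> N * (real n * K) * \<epsilon>"
    unfolding N_def K_def using binomial_neighbours_le[OF s(1) n0(4)] \<epsilon>
    by (intro mult_right_mono) auto
  finally have "(N * real n / 2) * exp (- c) \<le> (N * real n / 2) * (2 * \<epsilon> * K)"
    by (simp add: mult_ac)
  then have "exp (- c) \<le> 2 * \<epsilon> * K"
    using N n0 by (subst (asm) mult_le_cancel_left_pos) auto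
  then have "1 / K * (1 / (2 * \<epsilon>)) \<le> exp c"
    using K \<epsilon> by (simp add: exp_minus field_simps)
  also have "1 / K = real s * ((real n - real s) / (real n + 1))"
    by (simp add: K_def)
  finally have "real s * ((real n - real s) / (real n + 1)) * (1 / (2 * \<epsilon>)) \<le> exp c" .
  then have "ln (real s * ((real n - real s) / (real n + 1)) * (1 / (2 * \<epsilon>))) \<le> ln (exp c)"
    using n0 \<epsilon> by (intro ln_mono) simp_all
  moreover have "real s > 0" "(real n - real s) / (real n + 1) > 0" "1 / (2 * \<epsilon>) > 0"
    using n0 \<epsilon> by simp_all
  ultimately have "ln (real s) + ln ((real n - real s) / (real n + 1)) + ln (1 / (2 * \<epsilon>)) \<le> c"
    by (metis ln_mult_pos mult_pos_pos ln_exp)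
  then have "2 * real n / m * (ln (real s) + ln ((real n - real s) / (real n + 1)) + ln (1 / (2 * \<epsilon>)))
      \<le> 2 * real n / m * c"
    using m by (intro mult_left_mono) auto
  also have "\<dots> = \<mu>\<^sup>2" using m n0 by (simp add: c_def)
  \<comment> \<open>The square root is monotone on all reals, so the sign of the logarithmic
    expression needs no case distinction.\<close>
  finally show ?thesis using \<mu> by (metis real_sqrt_le_mono real_sqrt_abs abs_of_pos)
qed

end
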